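(* Let $E,J,R\in\mathbb R^{n,n}$ with $J=-J^T$, $R=R^T\ge0$, $E=E^T\ge0$, consider the dHDAE $E\dot z=(J-R)z$, and suppose that the pencil $\lambda E-(J-R)$ is regular and of (Kronecker) index at most one. (i) If $\lambda_0\in\mathbb C$ is an eigenvalue of $\lambda E-(J-R)$, then $\operatorname{Re}(\lambda_0)\le0$. (ii) If $\omega\in\mathbb R$ and $\lambda_0=i\omega$ is an eigenvalue of $\lambda E-(J-R)$, then $\lambda_0$ is semisimple. Moreover, if the columns of $V\in\mathbb C^{n,k}$ form a basis of a regular deflating subspace of $\lambda E-(J-R)$ associated with the eigenvalue $\lambda_0$, then $RV=0$.
   Context: A pencil $\lambda E-A$ of square matrices is regular if $\det(\lambda_0E-A)\ne0$ for some $\lambda_0\in\mathbb C$. Its (Kronecker) index is the size of the largest nilpotent block (associated with the eigenvalue $\infty$) in its Weierstrass/Kronecker canonical form, and $0$ if $E$ is invertible. For a regular pencil, finite eigenvalues are the $\lambda_0\in\mathbb C$ with $\det(\lambda_0E-A)=0$; such an eigenvalue is semisimple if all Jordan blocks associated with it in the Weierstrass canonical form have size $1$. The columns of $V\in\mathbb C^{n,k}$ form a basis of a regular deflating subspace of $\lambda E-(J-R)$ associated with $\lambda_0$ if $V$ has full column rank and there exist $W\in\mathbb C^{n,k}$ of full column rank and $T\in\mathbb C^{k,k}$ whose only eigenvalue is $\lambda_0$ such that $EV=W$ and $(J-R)V=WT$. *)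

theory Defs
  imports
    "Jordan_Normal_Form.Jordan_Normal_Form_Existence"
    "Jordan_Normal_Form.DL_Rank"
    "Jordan_Normal_Form.Spectral_Radius"
begin

definition pos_semidef :: "nat \<Rightarrow> real mat \<Rightarrow> bool" where
  "pos_semidef n A \<longleftrightarrow>
     A \<in> carrier_mat n n \<and> transpose_mat A = A \<and>
     (\<forall>x \<in> carrier_vec n. 0 \<le> x \<bullet> (A *\<^sub>v x))"

abbreviation complexify :: "real mat \<Rightarrow> complex mat" where
  "complexify \<equiv> map_mat complex_of_real"

text \<open>Below, a pair \<open>E\<close>, \<open>A\<close> of \<open>n \<times> n\<close> matrices stands for the pencil \<open>\<lambda>E - A\<close>.\<close>

definition regular_pencil :: "complex mat \<Rightarrow> complex mat \<Rightarrow> bool" where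
  "regular_pencil E A \<longleftrightarrow> (\<exists>l. det (l \<cdot>\<^sub>m E - A) \<noteq> 0)"

definition pencil_eigenvalue :: "complex mat \<Rightarrow> complex mat \<Rightarrow> complex \<Rightarrow> bool" where
  "pencil_eigenvalue E A l \<longleftrightarrow> det (l \<cdot>\<^sub>m E - A) = 0"

text \<open>The Weierstrass canonical form
  \<open>P (\<lambda>E - A) Q = diag (\<lambda>I - J, \<lambda>N - I)\<close>. The list \<open>fs\<close> holds the sizes and eigenvalues of the
  Jordan blocks of the finite part \<open>J\<close>, and \<open>is\<close> the sizes of the nilpotent Jordan blocks of \<open>N\<close>,
  which belong to the eigenvalue \<open>\<infinity>\<close>. Both parts may be empty.\<close>

definition weierstrass_form ::
  "nat \<Rightarrow> complex mat \<Rightarrow> complex mat \<Rightarrow> (nat \<times> complex) list \<Rightarrow> nat list \<Rightarrow> bool" where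
  "weierstrass_form n E A fs is \<longleftrightarrow>
     0 \<notin> fst ` set fs \<and> 0 \<notin> set is \<and>
     (\<exists>P \<in> carrier_mat n n. \<exists>Q \<in> carrier_mat n n.
        invertible_mat P \<and> invertible_mat Q \<and>
        (let r = sum_list (map fst fs); s = sum_list is in
           P * E * Q = four_block_mat (1\<^sub>m r) (0\<^sub>m r s)
                                      (0\<^sub>m s r) (jordan_matrix (map (\<lambda>m. (m, 0)) is)) \<and>
           P * A * Q = four_block_mat (jordan_matrix fs) (0\<^sub>m r s)
                                      (0\<^sub>m s r) (1\<^sub>m s)))"

text \<open>For a regular pencil the canonical form exists and is unique up to the order of the blocks,
  so the choice below is between equal values. The inserted \<open>0\<close> is the index when there is no block
  for \<open>\<infinity>\<close>, that is, when \<open>E\<close> is invertible.\<close>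

definition kronecker_index :: "nat \<Rightarrow> complex mat \<Rightarrow> complex mat \<Rightarrow> nat" where
  "kronecker_index n E A =
     (SOME \<nu>. \<exists>fs is. weierstrass_form n E A fs is \<and> \<nu> = Max (insert 0 (set is)))"

text \<open>The existence conjunct keeps the condition on the blocks from holding vacuously.\<close>

definition semisimple_eigenvalue ::
  "nat \<Rightarrow> complex mat \<Rightarrow> complex mat \<Rightarrow> complex \<Rightarrow> bool" where
  "semisimple_eigenvalue n E A l \<longleftrightarrow>
     pencil_eigenvalue E A l \<and>
     (\<exists>fs is. weierstrass_form n E A fs is) \<and>
     (\<forall>fs is. weierstrass_form n E A fs is \<longrightarrow> (\<forall>m. (m, l) \<in> set fs \<longrightarrow> m = 1))"

definition full_column_rank :: "nat \<Rightarrow> nat \<Rightarrow> complex mat \<Rightarrow> bool" where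
  "full_column_rank n k V \<longleftrightarrow> V \<in> carrier_mat n k \<and> vec_space.rank n V = k"

definition regular_deflating_basis ::
  "nat \<Rightarrow> nat \<Rightarrow> complex mat \<Rightarrow> complex mat \<Rightarrow> complex \<Rightarrow> complex mat \<Rightarrow> bool" where
  "regular_deflating_basis n k E A l V \<longleftrightarrow>
     full_column_rank n k V \<and>
     (\<exists>W T. full_column_rank n k W \<and> T \<in> carrier_mat k k \<and> spectrum T = {l} \<and>
        E * V = W \<and> A * V = W * T)"

end

theory Submission
  imports Defs
begin

text \<open>
  Let \<open>x \<noteq> 0\<close> be an eigenvector, \<open>(J - R) x = \<lambda> E x\<close>. Multiplying by \<open>x\<^sup>*\<close> and taking real parts gives
  \<open>Re \<lambda> (x\<^sup>* E x) = - x\<^sup>* R x\<close> (\<open>energy_balance\<close>). Regularity forces \<open>E x \<noteq> 0\<close>, hence \<open>x\<^sup>* E x > 0\<close> and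
  \<open>Re \<lambda> \<le> 0\<close>. If \<open>\<lambda>\<close> is on the imaginary axis, then \<open>x\<^sup>* R x = 0\<close>, and so \<open>R x = 0\<close>. It follows that
  \<open>x\<^sup>* (J - R - \<lambda>E) = 0\<close>: right eigenvectors are also left eigenvectors. If \<open>x\<close> began a Jordan chain
  of length two, \<open>(J - R - \<lambda>E) w = E x\<close>, then \<open>x\<^sup>* E x\<close> would vanish (\<open>no_imaginary_jordan_chain\<close>).

  A block of size at least two for \<open>\<lambda>\<close> in a Weierstrass form, or in the Jordan form of the matrix \<open>T\<close>
  of a deflating subspace, would produce such a chain with \<open>E x \<noteq> 0\<close>. Thus \<open>\<lambda>\<close> is semisimple, and
  \<open>T = \<lambda> I\<close>, so that every vector in the range of \<open>V\<close> satisfies the eigenvector equation and is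
  annihilated by \<open>R\<close>.

  Semisimplicity includes the existence of a Weierstrass form. This is proved for every regular
  complex pencil (\<open>weierstrass_form_exists\<close>) by reduction to the Jordan normal form.
\<close>

section \<open>Quadratic forms of real matrices on complex vectors\<close>

lemma Re_complexify_mult_vec:
  assumes "A \<in> carrier_mat m n" "x \<in> carrier_vec n"
  shows "map_vec Re (complexify A *\<^sub>v x) = A *\<^sub>v map_vec Re x"
    and "map_vec Im (complexify A *\<^sub>v x) = A *\<^sub>v map_vec Im x"
  using assms by (auto intro!: eq_vecI simp: scalar_prod_def)

lemma conjugate_scalar_prod_parts:
  fixes x y :: "complex vec"
  assumes "x \<in> carrier_vec n" "y \<in> carrier_vec n"
  shows "Re (conjugate x \<bullet> y) = map_vec Re x \<bullet> map_vec Re y + map_vec Im x \<bullet> map_vec Im y"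
    and "Im (conjugate x \<bullet> y) = map_vec Re x \<bullet> map_vec Im y - map_vec Im x \<bullet> map_vec Re y"
  using assms by (auto simp: scalar_prod_def sum.distrib sum_subtractf)

lemma transpose_bilinear:
  fixes A :: "'a :: comm_semiring_0 mat"
  assumes A: "A \<in> carrier_mat m n" and x: "x \<in> carrier_vec m" and y: "y \<in> carrier_vec n"
  shows "x \<bullet> (A *\<^sub>v y) = (transpose_mat A *\<^sub>v x) \<bullet> y"
proof -
  have "transpose_mat A *\<^sub>v x = vec n (\<lambda>j. x \<bullet> col A j)"
    using A x by (auto intro!: eq_vecI simp: comm_scalar_prod[of _ m])
  moreover have "A *\<^sub>v y = vec m (\<lambda>i. row A i \<bullet> y)"
    using A by (auto intro!: eq_vecI)
  ultimately show ?thesis using assoc_scalar_prod[OF x A y] by simp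
qed

text \<open>The polynomial \<open>t \<mapsto> (a + t e)\<^sup>T A (a + t e)\<close> with \<open>e = A a\<close> is nonnegative and has no constant term,
  so its linear coefficient \<open>2 e\<^sup>T e\<close> vanishes.\<close>

lemma pos_semidef_isotropic_kernel:
  assumes psd: "pos_semidef n A" and a: "a \<in> carrier_vec n" and q0: "a \<bullet> (A *\<^sub>v a) = 0"
  shows "A *\<^sub>v a = 0\<^sub>v n"
proof -
  have A: "A \<in> carrier_mat n n" and sym: "transpose_mat A = A"
    and pos: "\<And>x. x \<in> carrier_vec n \<Longrightarrow> 0 \<le> x \<bullet> (A *\<^sub>v x)"
    using psd by (auto simp: pos_semidef_def)
  define e where "e = A *\<^sub>v a"
  have e: "e \<in> carrier_vec n" using A a by (simp add: e_def)
  define p where "p = e \<bullet> e"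
  define q where "q = e \<bullet> (A *\<^sub>v e)"
  have ae: "a \<bullet> (A *\<^sub>v e) = p"
    using transpose_bilinear[OF A a e] by (simp add: sym e_def[symmetric] p_def)
  have "0 \<le> 2 * t * p + t\<^sup>2 * q" for t :: real
  proof -
    have "(a + t \<cdot>\<^sub>v e) \<bullet> (A *\<^sub>v (a + t \<cdot>\<^sub>v e)) = 2 * t * p + t\<^sup>2 * q"
      using A a e q0 ae
      by (simp add: mult_add_distrib_mat_vec[of _ n n] mult_mat_vec[of _ n n]
          add_scalar_prod_distrib[of _ n] scalar_prod_add_distrib[of _ n] e_def[symmetric]
          p_def[symmetric] q_def[symmetric] comm_scalar_prod[of a n e] power2_eq_square algebra_simps)
    thus ?thesis using pos[of "a + t \<cdot>\<^sub>v e"] a e by simp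
  qed
  hence *: "\<And>t::real. 0 \<le> 2 * t * p + t\<^sup>2 * q" .
  have q: "0 \<le> q" using pos[OF e] by (simp add: q_def)
  \<comment> \<open>At the minimiser \<open>t = -p / q\<close> the polynomial has the value \<open>-p\<^sup>2 / q\<close>;
    for \<open>q = 0\<close> it is linear.\<close>
  have "p = 0"
  proof (cases "q = 0")
    case True
    show ?thesis using *[of "-p"] True by (auto simp: mult_le_0_iff)
  next
    case False
    show ?thesis using *[of "- p / q"] False q by (simp add: power2_eq_square field_simps)
      (smt (verit) mult_eq_0_iff zero_le_mult_iff)
  qed
  hence "e \<bullet>c e = 0" by (simp add: p_def)
  hence "e = 0\<^sub>v n" using e conjugate_square_eq_0_vec[of e n] by simp
  thus ?thesis by (simp add: e_def)
qed

lemma pos_semidef_complexify: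
  assumes psd: "pos_semidef n A" and x: "x \<in> carrier_vec n"
  shows "Im (conjugate x \<bullet> (complexify A *\<^sub>v x)) = 0"
    and "0 \<le> Re (conjugate x \<bullet> (complexify A *\<^sub>v x))"
    and "Re (conjugate x \<bullet> (complexify A *\<^sub>v x)) = 0 \<Longrightarrow> complexify A *\<^sub>v x = 0\<^sub>v n"
proof -
  have A: "A \<in> carrier_mat n n" and sym: "transpose_mat A = A"
    and pos: "\<And>x. x \<in> carrier_vec n \<Longrightarrow> 0 \<le> x \<bullet> (A *\<^sub>v x)"
    using psd by (auto simp: pos_semidef_def)
  define a where "a = map_vec Re x"
  define b where "b = map_vec Im x"
  have a: "a \<in> carrier_vec n" and b: "b \<in> carrier_vec n" using x by (auto simp: a_def b_def)
  have Ax: "complexify A *\<^sub>v x \<in> carrier_vec n" using A x by simp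
  note parts = conjugate_scalar_prod_parts[OF x Ax] Re_complexify_mult_vec[OF A x]
  have re: "Re (conjugate x \<bullet> (complexify A *\<^sub>v x)) = a \<bullet> (A *\<^sub>v a) + b \<bullet> (A *\<^sub>v b)"
    and im: "Im (conjugate x \<bullet> (complexify A *\<^sub>v x)) = a \<bullet> (A *\<^sub>v b) - b \<bullet> (A *\<^sub>v a)"
    using parts by (simp_all add: a_def b_def)
  show "Im (conjugate x \<bullet> (complexify A *\<^sub>v x)) = 0"
    using im transpose_bilinear[OF A a b] A a b by (simp add: sym comm_scalar_prod[of _ n b])
  show "0 \<le> Re (conjugate x \<bullet> (complexify A *\<^sub>v x))" using re pos[OF a] pos[OF b] by simp
  assume "Re (conjugate x \<bullet> (complexify A *\<^sub>v x)) = 0"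
  hence "a \<bullet> (A *\<^sub>v a) = 0" "b \<bullet> (A *\<^sub>v b) = 0" using re pos[OF a] pos[OF b] by auto
  hence "A *\<^sub>v a = 0\<^sub>v n" "A *\<^sub>v b = 0\<^sub>v n"
    using pos_semidef_isotropic_kernel[OF psd a] pos_semidef_isotropic_kernel[OF psd b] by blast+
  hence z: "map_vec Re (complexify A *\<^sub>v x) = 0\<^sub>v n" "map_vec Im (complexify A *\<^sub>v x) = 0\<^sub>v n"
    using parts by (simp_all add: a_def b_def)
  show "complexify A *\<^sub>v x = 0\<^sub>v n"
  proof (rule eq_vecI)
    fix i assume "i < dim_vec (0\<^sub>v n :: complex vec)"
    hence i: "i < n" by simp
    have "Re ((complexify A *\<^sub>v x) $ i) = 0" "Im ((complexify A *\<^sub>v x) $ i) = 0"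
      using arg_cong[OF z(1), of "\<lambda>v. v $ i"] arg_cong[OF z(2), of "\<lambda>v. v $ i"] i A
      by (simp_all del: index_mult_mat_vec)
    thus "(complexify A *\<^sub>v x) $ i = (0\<^sub>v n :: complex vec) $ i" using i by (simp add: complex_eq_iff del: index_mult_mat_vec)
  qed (use A in simp)
qed

lemma skew_complexify:
  assumes J: "J \<in> carrier_mat n n" and skew: "J = - transpose_mat J" and x: "x \<in> carrier_vec n"
  shows "Re (conjugate x \<bullet> (complexify J *\<^sub>v x)) = 0"
proof -
  have *: "a \<bullet> (J *\<^sub>v a) = 0" if a: "a \<in> carrier_vec n" for a
  proof -
    have JT: "transpose_mat J = - J" using skew by (metis uminus_uminus_mat)
    have "a \<bullet> (J *\<^sub>v a) = - (a \<bullet> (J *\<^sub>v a))"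
      using transpose_bilinear[OF J a a] J a comm_scalar_prod[of "J *\<^sub>v a" n a] by (simp add: JT)
    thus ?thesis by simp
  qed
  have "complexify J *\<^sub>v x \<in> carrier_vec n" using J x by simp
  from conjugate_scalar_prod_parts[OF x this] Re_complexify_mult_vec[OF J x] show ?thesis
    using x *[of "map_vec Re x"] *[of "map_vec Im x"] by simp
qed

lemma conjugate_complexify_mult_vec:
  assumes "A \<in> carrier_mat m n" "x \<in> carrier_vec n"
  shows "conjugate (complexify A *\<^sub>v x) = complexify A *\<^sub>v conjugate x"
  using assms by (auto intro!: eq_vecI simp: scalar_prod_def)

section \<open>Energy balance of dissipative pencils\<close>

lemma smult_mat_mult_vec:
  fixes A :: "'a :: comm_semiring_0 mat"
  assumes "A \<in> carrier_mat m n" "x \<in> carrier_vec n"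
  shows "(a \<cdot>\<^sub>m A) *\<^sub>v x = a \<cdot>\<^sub>v (A *\<^sub>v x)"
  using assms by (auto intro!: eq_vecI simp: scalar_prod_def sum_distrib_left mult.assoc)

lemma complexify_uminus: "complexify (- A) = - complexify A"
  by (rule eq_matI) auto

lemma complexify_minus:
  assumes "A \<in> carrier_mat m n" "B \<in> carrier_mat m n"
  shows "complexify (A - B) = complexify A - complexify B"
  using assms by (intro eq_matI) auto

lemma det_pencil_zero_iff:
  fixes E A :: "complex mat"
  assumes E: "E \<in> carrier_mat n n" and A: "A \<in> carrier_mat n n"
  shows "det (l \<cdot>\<^sub>m E - A) = 0 \<longleftrightarrow>
    (\<exists>x \<in> carrier_vec n. x \<noteq> 0\<^sub>v n \<and> A *\<^sub>v x = l \<cdot>\<^sub>v (E *\<^sub>v x))"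
proof -
  have "(l \<cdot>\<^sub>m E - A) *\<^sub>v x = 0\<^sub>v n \<longleftrightarrow> A *\<^sub>v x = l \<cdot>\<^sub>v (E *\<^sub>v x)"
    if x: "x \<in> carrier_vec n" for x
  proof -
    have "(l \<cdot>\<^sub>m E - A) *\<^sub>v x = (l \<cdot>\<^sub>v (E *\<^sub>v x)) - A *\<^sub>v x"
      using E A x by (simp add: minus_mult_distrib_mat_vec[of _ n n] smult_mat_mult_vec[of _ n n])
    moreover have "u - v = 0\<^sub>v n \<longleftrightarrow> v = u"
      if "u \<in> carrier_vec n" "v \<in> carrier_vec n" for u v :: "complex vec"
      using that by (auto simp: vec_eq_iff)
    ultimately show ?thesis using E A x by simp
  qed
  thus ?thesis
    using det_0_iff_vec_prod_zero[of "l \<cdot>\<^sub>m E - A" n] E A by (auto simp: minus_carrier_mat)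
qed

text \<open>An eigenvector in the kernel of \<open>E\<close> lies in the kernel of \<open>A\<close> as well, which makes
  \<open>\<lambda>E - A\<close> singular for every \<open>\<lambda>\<close>.\<close>

lemma regular_pencil_no_common_kernel:
  assumes E: "E \<in> carrier_mat n n" and A: "A \<in> carrier_mat n n" and reg: "regular_pencil E A"
    and x: "x \<in> carrier_vec n" "x \<noteq> 0\<^sub>v n" and Ax: "A *\<^sub>v x = l \<cdot>\<^sub>v (E *\<^sub>v x)"
  shows "E *\<^sub>v x \<noteq> 0\<^sub>v n"
proof
  assume "E *\<^sub>v x = 0\<^sub>v n"
  moreover have "k \<cdot>\<^sub>v 0\<^sub>v n = (0\<^sub>v n :: complex vec)" for k by auto
  ultimately have "A *\<^sub>v x = m \<cdot>\<^sub>v (E *\<^sub>v x)" for m using Ax by simp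
  hence "det (m \<cdot>\<^sub>m E - A) = 0" for m using det_pencil_zero_iff[OF E A] x by blast
  thus False using reg by (simp add: regular_pencil_def)
qed

text \<open>The coefficients of a dissipative Hamiltonian system \<open>E z' = (J - R) z\<close>. The complexified
  coefficients are written \<open>\<E>\<close>, \<open>\<R>\<close> and \<open>\<A> = J - R\<close>.\<close>

locale dissipative_pencil =
  fixes n :: nat and E J R :: "real mat"
  assumes J: "J \<in> carrier_mat n n"
    and skew: "J = - transpose_mat J"
    and psd_R: "pos_semidef n R"
    and psd_E: "pos_semidef n E"
begin

abbreviation "\<E> \<equiv> complexify E"
abbreviation "\<R> \<equiv> complexify R"
abbreviation "\<A> \<equiv> complexify (J - R)"

lemma carriers [simp]:
  "E \<in> carrier_mat n n" "R \<in> carrier_mat n n" "\<E> \<in> carrier_mat n n"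
  "\<R> \<in> carrier_mat n n" "\<A> \<in> carrier_mat n n"
  "J - R \<in> carrier_mat n n"
  using J psd_R psd_E by (auto simp: pos_semidef_def)

lemma A_mult_vec:
  assumes "x \<in> carrier_vec n"
  shows "\<A> *\<^sub>v x = complexify J *\<^sub>v x - \<R> *\<^sub>v x"
proof -
  have "\<A> = complexify J - \<R>" using complexify_minus[OF J carriers(2)] .
  thus ?thesis using assms J by (simp add: minus_mult_distrib_mat_vec[of _ n n])
qed

text \<open>The real part of \<open>x\<^sup>* (J - R) x = \<lambda> x\<^sup>* E x\<close>: the form of \<open>J\<close> is purely imaginary, and the forms of
  \<open>E\<close> and \<open>R\<close> are real.\<close>

lemma energy_balance:
  assumes x: "x \<in> carrier_vec n" and ev: "\<A> *\<^sub>v x = l \<cdot>\<^sub>v (\<E> *\<^sub>v x)"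
  shows "Re l * Re (conjugate x \<bullet> (\<E> *\<^sub>v x)) = - Re (conjugate x \<bullet> (\<R> *\<^sub>v x))"
proof -
  have JR: "complexify J *\<^sub>v x \<in> carrier_vec n" "\<R> *\<^sub>v x \<in> carrier_vec n" "\<E> *\<^sub>v x \<in> carrier_vec n"
    using J x by (auto intro!: mult_mat_vec_carrier)
  have "conjugate x \<bullet> (\<A> *\<^sub>v x) = l * (conjugate x \<bullet> (\<E> *\<^sub>v x))"
    using x JR by (simp add: ev scalar_prod_smult_distrib[of _ n])
  moreover have "conjugate x \<bullet> (\<A> *\<^sub>v x)
      = conjugate x \<bullet> (complexify J *\<^sub>v x) - conjugate x \<bullet> (\<R> *\<^sub>v x)"
    using x JR by (simp add: A_mult_vec scalar_prod_minus_distrib[of _ n])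
  ultimately have "Re (l * (conjugate x \<bullet> (\<E> *\<^sub>v x))) = - Re (conjugate x \<bullet> (\<R> *\<^sub>v x))"
    using skew_complexify[OF J skew x] by (metis diff_0 minus_complex.simps(1))
  thus ?thesis using pos_semidef_complexify(1)[OF psd_E x] by simp
qed

lemma eigenvalue_Re_nonpos:
  assumes reg: "regular_pencil \<E> \<A>" and ev: "pencil_eigenvalue \<E> \<A> l"
  shows "Re l \<le> 0"
proof -
  obtain x where x: "x \<in> carrier_vec n" "x \<noteq> 0\<^sub>v n" and Ax: "\<A> *\<^sub>v x = l \<cdot>\<^sub>v (\<E> *\<^sub>v x)"
    using ev det_pencil_zero_iff[OF carriers(3,5)] unfolding pencil_eigenvalue_def by blast
  have "\<E> *\<^sub>v x \<noteq> 0\<^sub>v n" using regular_pencil_no_common_kernel[OF _ _ reg x Ax] by simp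
  hence "0 < Re (conjugate x \<bullet> (\<E> *\<^sub>v x))"
    using pos_semidef_complexify(2,3)[OF psd_E x(1)] by fastforce
  moreover have "Re l * Re (conjugate x \<bullet> (\<E> *\<^sub>v x)) \<le> 0"
    using energy_balance[OF x(1) Ax] pos_semidef_complexify(2)[OF psd_R x(1)] by simp
  ultimately show ?thesis by (simp add: mult_le_0_iff)
qed

lemma imaginary_eigenvector_in_kernel_R:
  assumes x: "x \<in> carrier_vec n" and ev: "\<A> *\<^sub>v x = l \<cdot>\<^sub>v (\<E> *\<^sub>v x)" and im: "Re l = 0"
  shows "\<R> *\<^sub>v x = 0\<^sub>v n"
  using energy_balance[OF x ev] im pos_semidef_complexify(3)[OF psd_R x] by simp

text \<open>A Jordan chain \<open>u, w\<close> of length two at a point of the imaginary axis has \<open>E u = 0\<close>: the vector \<open>u\<^sup>*\<close>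
  is a left eigenvector, so it annihilates \<open>(J - R - \<lambda>E) w = E u\<close>, and \<open>u\<^sup>* E u = 0\<close>. Both
  semisimplicity and the statement on deflating subspaces follow from this.\<close>

lemma no_imaginary_jordan_chain:
  assumes u: "u \<in> carrier_vec n" and w: "w \<in> carrier_vec n" and im: "Re l = 0"
    and Au: "\<A> *\<^sub>v u = l \<cdot>\<^sub>v (\<E> *\<^sub>v u)"
    and Aw: "\<A> *\<^sub>v w = l \<cdot>\<^sub>v (\<E> *\<^sub>v w) + \<E> *\<^sub>v u"
  shows "\<E> *\<^sub>v u = 0\<^sub>v n"
proof -
  let ?c = "conjugate u"
  have c: "?c \<in> carrier_vec n" using u by simp
  have Eu: "\<E> *\<^sub>v u \<in> carrier_vec n" and Ew: "\<E> *\<^sub>v w \<in> carrier_vec n"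
    and Ju: "complexify J *\<^sub>v u \<in> carrier_vec n"
    using u w c J by (auto intro!: mult_mat_vec_carrier)
  have cnj: "cnj l = - l" using im by (simp add: complex_eq_iff)
  have ET: "transpose_mat \<E> = \<E>" and RT: "transpose_mat \<R> = \<R>" and JT: "transpose_mat J = - J"
    using psd_E psd_R skew
    by (simp_all add: pos_semidef_def map_mat_transpose, metis uminus_uminus_mat)
  have Ru: "\<R> *\<^sub>v u = 0\<^sub>v n" by (rule imaginary_eigenvector_in_kernel_R[OF u Au im])
  have Rc: "\<R> *\<^sub>v ?c = 0\<^sub>v n"
    using conjugate_complexify_mult_vec[OF carriers(2) u] Ru by simp
  have "complexify J *\<^sub>v u = l \<cdot>\<^sub>v (\<E> *\<^sub>v u)" using Au A_mult_vec[OF u] Ru Ju by simp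
  hence "conjugate (complexify J *\<^sub>v u) = conjugate (l \<cdot>\<^sub>v (\<E> *\<^sub>v u))" by simp
  hence Jc_eq: "complexify J *\<^sub>v ?c = - l \<cdot>\<^sub>v (\<E> *\<^sub>v ?c)"
    using conjugate_complexify_mult_vec[OF J u] conjugate_complexify_mult_vec[OF carriers(1) u] cnj
    by (simp add: conjugate_smult_vec)
  \<comment> \<open>\<open>u\<^sup>*\<close> is a left eigenvector, because \<open>J\<close> is skew and the sign of \<open>R\<close> does not matter
    on \<open>u\<close>.\<close>
  have "transpose_mat \<A> *\<^sub>v ?c = l \<cdot>\<^sub>v (\<E> *\<^sub>v ?c)"
  proof -
    have "transpose_mat \<A> = - complexify J - \<R>"
    proof -
      have "transpose_mat (J - R) = - J - R"
        using J JT psd_R by (simp add: transpose_minus[of _ n n] pos_semidef_def)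
      thus ?thesis
        using complexify_minus[of "- J" n n R] J by (simp add: map_mat_transpose complexify_uminus)
    qed
    hence "transpose_mat \<A> *\<^sub>v ?c = - (complexify J *\<^sub>v ?c) - \<R> *\<^sub>v ?c"
      using J c uminus_mult_mat_vec[of ?c "complexify J"] carrier_matD(2)[OF J] carrier_vecD[OF u]
      by (simp add: minus_mult_distrib_mat_vec[of _ n n])
    also have "\<dots> = l \<cdot>\<^sub>v (\<E> *\<^sub>v ?c)"
    proof -
      have "- (- l \<cdot>\<^sub>v z) - 0\<^sub>v n = l \<cdot>\<^sub>v z" if "z \<in> carrier_vec n" for z
        using that by (intro eq_vecI) auto
      thus ?thesis unfolding Rc Jc_eq using mult_mat_vec_carrier[OF carriers(3) c] by blast
    qed
    finally show ?thesis .
  qed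
  hence "?c \<bullet> (\<A> *\<^sub>v w) = (l \<cdot>\<^sub>v (\<E> *\<^sub>v ?c)) \<bullet> w"
    using transpose_bilinear[OF carriers(5) c w] by simp
  also have "\<dots> = l * ((\<E> *\<^sub>v ?c) \<bullet> w)"
    using mult_mat_vec_carrier[OF carriers(3) c] w by (rule smult_scalar_prod_distrib)
  also have "(\<E> *\<^sub>v ?c) \<bullet> w = ?c \<bullet> (\<E> *\<^sub>v w)"
    using transpose_bilinear[OF carriers(3) c w] by (simp add: ET)
  finally have "l * (?c \<bullet> (\<E> *\<^sub>v w)) = l * (?c \<bullet> (\<E> *\<^sub>v w)) + ?c \<bullet> (\<E> *\<^sub>v u)"
    using c Eu Ew by (simp add: Aw scalar_prod_add_distrib[of _ n])
  hence "?c \<bullet> (\<E> *\<^sub>v u) = 0" by simp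
  thus ?thesis using pos_semidef_complexify(3)[OF psd_E u] by simp
qed

end

section \<open>Jordan matrices\<close>

lemma jordan_block_chain:
  fixes a :: "'a :: comm_ring_1"
  assumes m: "2 \<le> m"
  shows "jordan_block m a *\<^sub>v unit_vec m 0 = a \<cdot>\<^sub>v unit_vec m 0"
    and "jordan_block m a *\<^sub>v unit_vec m 1 = a \<cdot>\<^sub>v unit_vec m 1 + unit_vec m 0"
  using m by (auto intro!: eq_vecI)

text \<open>A block of size at least two contributes a Jordan chain \<open>x, y\<close>: its first two coordinate vectors,
  padded with zeros.\<close>

lemma jordan_matrix_chain:
  fixes l :: "'a :: comm_ring_1"
  assumes "(m, l) \<in> set fs" and m: "2 \<le> m"
  shows "\<exists>x y. x \<in> carrier_vec (sum_list (map fst fs)) \<and> y \<in> carrier_vec (sum_list (map fst fs)) \<and>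
    x \<noteq> 0\<^sub>v (sum_list (map fst fs)) \<and>
    jordan_matrix fs *\<^sub>v x = l \<cdot>\<^sub>v x \<and> jordan_matrix fs *\<^sub>v y = l \<cdot>\<^sub>v y + x"
  using assms(1)
proof (induction fs)
  case (Cons f fs)
  obtain k a where f: "f = (k, a)" by force
  let ?r = "sum_list (map fst fs)"
  have zero: "0\<^sub>v (k + ?r) = 0\<^sub>v k @\<^sub>v 0\<^sub>v ?r" by (auto intro!: eq_vecI)
  have mult: "jordan_matrix (f # fs) *\<^sub>v (u @\<^sub>v v) = (jordan_block k a *\<^sub>v u) @\<^sub>v (jordan_matrix fs *\<^sub>v v)"
    if "u \<in> carrier_vec k" "v \<in> carrier_vec ?r" for u v
    unfolding f jordan_matrix_Cons using that by (intro mult_mat_vec_split) auto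
  have zeros: "jordan_matrix fs *\<^sub>v 0\<^sub>v ?r = 0\<^sub>v ?r" "jordan_block k a *\<^sub>v 0\<^sub>v k = 0\<^sub>v k"
    by (auto intro!: eq_vecI)
  show ?case
  proof (cases "f = (m, l)")
    case True
    hence k: "k = m" "a = l" using f by auto
    let ?x = "unit_vec m 0 @\<^sub>v 0\<^sub>v ?r" and ?y = "unit_vec m 1 @\<^sub>v 0\<^sub>v ?r"
    have "?x $ 0 \<noteq> 0\<^sub>v (m + ?r) $ 0" using m by simp
    hence "?x \<noteq> 0\<^sub>v (m + ?r)" by metis
    moreover have "jordan_matrix (f # fs) *\<^sub>v ?x = l \<cdot>\<^sub>v ?x"
      using mult[of "unit_vec m 0" "0\<^sub>v ?r"] jordan_block_chain(1)[OF m, of l] zeros k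
      by (auto intro!: eq_vecI)
    moreover have "jordan_matrix (f # fs) *\<^sub>v ?y = l \<cdot>\<^sub>v ?y + ?x"
      using mult[of "unit_vec m 1" "0\<^sub>v ?r"] jordan_block_chain(2)[OF m, of l] zeros k
      by (auto intro!: eq_vecI)
    ultimately show ?thesis using f k
      by (intro exI[of _ ?x] exI[of _ ?y]) (auto intro!: append_carrier_vec)
  next
    case False
    then obtain x y where xy: "x \<in> carrier_vec ?r" "y \<in> carrier_vec ?r" "x \<noteq> 0\<^sub>v ?r"
      "jordan_matrix fs *\<^sub>v x = l \<cdot>\<^sub>v x" "jordan_matrix fs *\<^sub>v y = l \<cdot>\<^sub>v y + x"
      using Cons by auto
    let ?x = "0\<^sub>v k @\<^sub>v x" and ?y = "0\<^sub>v k @\<^sub>v y"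
    have "?x \<noteq> 0\<^sub>v (k + ?r)" using xy append_vec_eq[of "0\<^sub>v k" k "0\<^sub>v k" x "0\<^sub>v ?r"] by (simp add: zero)
    moreover have "jordan_matrix (f # fs) *\<^sub>v ?x = l \<cdot>\<^sub>v ?x"
      using mult[of "0\<^sub>v k" x] xy zeros by (auto intro!: eq_vecI)
    moreover have "jordan_matrix (f # fs) *\<^sub>v ?y = l \<cdot>\<^sub>v ?y + ?x"
      using mult[of "0\<^sub>v k" y] xy zeros by (auto intro!: eq_vecI)
    ultimately show ?thesis using f xy
      by (intro exI[of _ ?x] exI[of _ ?y]) (auto intro!: append_carrier_vec)
  qed
qed simp

lemma jordan_matrix_all_blocks_one:
  fixes l :: "'a :: comm_ring_1"
  assumes "\<And>m a. (m, a) \<in> set fs \<Longrightarrow> m = 1 \<and> a = l"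
  shows "jordan_matrix fs = l \<cdot>\<^sub>m 1\<^sub>m (sum_list (map fst fs))"
  using assms
proof (induction fs)
  case Nil
  show ?case by (auto simp: jordan_matrix_def)
next
  case (Cons f fs)
  have f: "f = (1, l)" using Cons.prems[of "fst f" "snd f"] by (cases f) auto
  let ?r = "sum_list (map fst fs)"
  have block: "jordan_block 1 l = l \<cdot>\<^sub>m 1\<^sub>m 1" by (rule eq_matI) auto
  have IH: "jordan_matrix fs = l \<cdot>\<^sub>m 1\<^sub>m ?r" using Cons by auto
  have "l \<cdot>\<^sub>m 1\<^sub>m (1 + ?r) = l \<cdot>\<^sub>m four_block_mat (1\<^sub>m 1) (0\<^sub>m 1 ?r) (0\<^sub>m ?r 1) (1\<^sub>m ?r)"
    by (simp only: four_block_one_mat)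
  also have "\<dots> = four_block_mat (l \<cdot>\<^sub>m 1\<^sub>m 1) (0\<^sub>m 1 ?r) (0\<^sub>m ?r 1) (l \<cdot>\<^sub>m 1\<^sub>m ?r)"
    using smult_four_block_mat[of "1\<^sub>m 1" 1 1 "0\<^sub>m 1 ?r" ?r "0\<^sub>m ?r 1" ?r "1\<^sub>m ?r" l] by simp
  finally show ?case by (simp only: f jordan_matrix_Cons block IH list.map fst_conv sum_list.Cons)
qed

lemma similar_mat_swap_blocks:
  fixes A D :: "'a :: comm_ring_1 mat"
  assumes A: "A \<in> carrier_mat n n" and D: "D \<in> carrier_mat m m"
  shows "similar_mat (four_block_mat A (0\<^sub>m n m) (0\<^sub>m m n) D) (four_block_mat D (0\<^sub>m m n) (0\<^sub>m n m) A)"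
proof -
  let ?P = "four_block_mat (0\<^sub>m n m :: 'a mat) (1\<^sub>m n) (1\<^sub>m m) (0\<^sub>m m n)"
  let ?Q = "four_block_mat (0\<^sub>m m n :: 'a mat) (1\<^sub>m m) (1\<^sub>m n) (0\<^sub>m n m)"
  let ?AD = "four_block_mat A (0\<^sub>m n m) (0\<^sub>m m n) D" and ?DA = "four_block_mat D (0\<^sub>m m n) (0\<^sub>m n m) A"
  have P: "?P \<in> carrier_mat (n + m) (n + m)" and Q: "?Q \<in> carrier_mat (n + m) (n + m)"
    by (rule carrier_matI; simp)+
  have PQ: "?P * ?Q = 1\<^sub>m (n + m)"
    using mult_four_block_mat[of "0\<^sub>m n m :: 'a mat" n m "1\<^sub>m n" n "1\<^sub>m m" m "0\<^sub>m m n" "0\<^sub>m m n" n "1\<^sub>m m" m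
        "1\<^sub>m n" "0\<^sub>m n m"] by simp
  have QP: "?Q * ?P = 1\<^sub>m (n + m)"
    using mult_four_block_mat[of "0\<^sub>m m n :: 'a mat" m n "1\<^sub>m m" m "1\<^sub>m n" n "0\<^sub>m n m" "0\<^sub>m n m" m "1\<^sub>m n" n
        "1\<^sub>m m" "0\<^sub>m m n"] by (simp add: add.commute)
  have "?P * ?DA = four_block_mat (0\<^sub>m n m) A D (0\<^sub>m m n)"
    using mult_four_block_mat[of "0\<^sub>m n m :: 'a mat" n m "1\<^sub>m n" n "1\<^sub>m m" m "0\<^sub>m m n" D m "0\<^sub>m m n" n
        "0\<^sub>m n m" A] A D by simp
  moreover have "four_block_mat (0\<^sub>m n m) A D (0\<^sub>m m n) * ?Q = ?AD"
    using mult_four_block_mat[of "0\<^sub>m n m" n m A n D m "0\<^sub>m m n" "0\<^sub>m m n" n "1\<^sub>m m" m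
        "1\<^sub>m n" "0\<^sub>m n m"] A D by simp
  ultimately have "?AD = ?P * ?DA * ?Q" by simp
  with PQ QP  have "similar_mat_wit ?AD ?DA ?P ?Q"
    using A D P Q by (intro similar_mat_witI[of _ _ "n + m"]) (auto simp: add.commute[of m n])
  thus ?thesis unfolding similar_mat_def by blast
qed

lemma jordan_matrix_append:
  "jordan_matrix (xs @ ys) = four_block_mat (jordan_matrix xs)
    (0\<^sub>m (sum_list (map fst xs)) (sum_list (map fst ys)))
    (0\<^sub>m (sum_list (map fst ys)) (sum_list (map fst xs))) (jordan_matrix ys)"
  unfolding jordan_matrix_def map_append diag_block_mat_append Let_def
  unfolding jordan_matrix_def[symmetric] jordan_matrix_dim ..

lemma similar_jordan_matrix_append_cong:
  fixes xs ys :: "(nat \<times> 'a :: comm_ring_1) list"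
  assumes "similar_mat (jordan_matrix xs) (jordan_matrix xs')"
    and "similar_mat (jordan_matrix ys) (jordan_matrix ys')"
  shows "similar_mat (jordan_matrix (xs @ ys)) (jordan_matrix (xs' @ ys'))"
proof -
  have size: "sum_list (map fst us) = sum_list (map fst vs)"
    if "similar_mat (jordan_matrix us) (jordan_matrix vs)" for us vs :: "(nat \<times> 'a) list"
    using similar_matD[OF that] by (metis carrier_matD(1) insert_subset jordan_matrix_dim(1))
  have "sum_list (map fst xs) = sum_list (map fst xs')" "sum_list (map fst ys) = sum_list (map fst ys')"
    using size assms by blast+
  thus ?thesis
    using similar_mat_four_block_0_0[OF assms jordan_matrix_carrier jordan_matrix_carrier]
    by (simp add: jordan_matrix_append)
qed

lemma similar_jordan_matrix_partition:
  fixes xs :: "(nat \<times> 'a :: comm_ring_1) list"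
  shows "similar_mat (jordan_matrix xs) (jordan_matrix (filter P xs @ filter (\<lambda>x. \<not> P x) xs))"
proof (induction xs)
  case Nil
  show ?case by (simp add: similar_mat_refl[OF jordan_matrix_carrier])
next
  case (Cons x xs)
  let ?p = "filter P xs" and ?q = "filter (\<lambda>x. \<not> P x) xs"
  have refl: "similar_mat (jordan_matrix zs) (jordan_matrix zs)" for zs :: "(nat \<times> 'a) list"
    by (rule similar_mat_refl[OF jordan_matrix_carrier])
  have *: "similar_mat (jordan_matrix (x # xs)) (jordan_matrix (x # ?p @ ?q))"
    using similar_jordan_matrix_append_cong[OF refl[of "[x]"] Cons.IH] by simp
  show ?case
  proof (cases "P x")
    case True
    thus ?thesis using * by simp
  next
    case False
    have "similar_mat (jordan_matrix ([x] @ ?p)) (jordan_matrix (?p @ [x]))"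
      unfolding jordan_matrix_append by (rule similar_mat_swap_blocks) auto
    from similar_mat_trans[OF * similar_jordan_matrix_append_cong[OF this refl[of ?q], simplified]]
    show ?thesis using False by simp
  qed
qed

lemma eigenvalue_jordan_matrixD:
  fixes c :: "'a :: field"
  assumes "eigenvalue (jordan_matrix fs) c"
  shows "c \<in> snd ` set fs"
proof -
  have "poly (\<Prod>(n, a)\<leftarrow>fs. [:- a, 1:] ^ n) c = 0"
    using assms eigenvalue_root_char_poly[OF jordan_matrix_carrier, of fs c]
    by (simp add: jordan_matrix_char_poly)
  thus ?thesis
    by (induction fs) (auto split: prod.splits)
qed

lemma eigenvalue_jordan_matrixI:
  fixes c :: "'a :: field"
  assumes "(n, c) \<in> set fs" "n \<noteq> 0"
  shows "eigenvalue (jordan_matrix fs) c"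
proof -
  have "poly (\<Prod>(n, a)\<leftarrow>fs. [:- a, 1:] ^ n) c = 0"
    using assms by (induction fs) (auto split: prod.splits)
  thus ?thesis
    using eigenvalue_root_char_poly[OF jordan_matrix_carrier, of fs c]
    by (simp add: jordan_matrix_char_poly)
qed

lemma jordan_nf_eigenvalue_iff:
  fixes c :: "'a :: field"
  assumes A: "A \<in> carrier_mat n n" and nf: "jordan_nf A fs"
  shows "eigenvalue A c \<longleftrightarrow> c \<in> snd ` set fs"
proof -
  have "char_poly A = char_poly (jordan_matrix fs)"
    using nf char_poly_similar by (auto simp: jordan_nf_def)
  hence "eigenvalue A c \<longleftrightarrow> eigenvalue (jordan_matrix fs) c"
    by (simp add: eigenvalue_root_char_poly[OF A] eigenvalue_root_char_poly[OF jordan_matrix_carrier])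
  moreover have "n \<noteq> 0" if "(n, c) \<in> set fs" for n
    using nf that by (force simp: jordan_nf_def)
  ultimately show ?thesis
    using eigenvalue_jordan_matrixD[of fs c] eigenvalue_jordan_matrixI[of _ c fs] by force
qed

lemma complex_jordan_nf_exists:
  fixes A :: "complex mat"
  assumes "A \<in> carrier_mat n n"
  obtains fs where "jordan_nf A fs"
  using char_poly_factorized[OF assms] jordan_nf_exists[OF assms] by blast

section \<open>Existence of the Weierstrass canonical form\<close>

text \<open>Strict equivalence of the pencils \<open>\<lambda>E - A\<close> and \<open>\<lambda>E' - A'\<close>: one pair \<open>P\<close>, \<open>Q\<close> of nonsingular
  matrices transforms both coefficients. Nonsingularity is expressed by the determinant.\<close>

definition strictly_equivalent ::
  "nat \<Rightarrow> complex mat \<Rightarrow> complex mat \<Rightarrow> complex mat \<Rightarrow> complex mat \<Rightarrow> bool" where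
  "strictly_equivalent n E A E' A' \<longleftrightarrow>
     (\<exists>P \<in> carrier_mat n n. \<exists>Q \<in> carrier_mat n n.
        det P \<noteq> 0 \<and> det Q \<noteq> 0 \<and> P * E * Q = E' \<and> P * A * Q = A')"

lemma strictly_equivalentI:
  assumes "P \<in> carrier_mat n n" "Q \<in> carrier_mat n n" "det P \<noteq> 0" "det Q \<noteq> 0"
    and "P * E * Q = E'" "P * A * Q = A'"
  shows "strictly_equivalent n E A E' A'"
  using assms unfolding strictly_equivalent_def by blast

lemma strictly_equivalent_trans:
  assumes E: "E \<in> carrier_mat n n" and A: "A \<in> carrier_mat n n"
    and 1: "strictly_equivalent n E A E' A'" and 2: "strictly_equivalent n E' A' E'' A''"
  shows "strictly_equivalent n E A E'' A''"
proof -
  obtain P Q where PQ: "P \<in> carrier_mat n n" "Q \<in> carrier_mat n n" "det P \<noteq> 0" "det Q \<noteq> 0"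
    "P * E * Q = E'" "P * A * Q = A'"
    using 1 unfolding strictly_equivalent_def by blast
  obtain P' Q' where PQ': "P' \<in> carrier_mat n n" "Q' \<in> carrier_mat n n" "det P' \<noteq> 0" "det Q' \<noteq> 0"
    "P' * E' * Q' = E''" "P' * A' * Q' = A''"
    using 2 unfolding strictly_equivalent_def by blast
  have comp: "(P' * P) * M * (Q * Q') = P' * (P * M * Q) * Q'" if "M \<in> carrier_mat n n" for M
    using that PQ(1,2) PQ'(1,2) by (simp add: assoc_mult_mat[of _ n n _ n _ n])
  show ?thesis
  proof (rule strictly_equivalentI)
    show "P' * P \<in> carrier_mat n n" "Q * Q' \<in> carrier_mat n n"
      using PQ(1,2) PQ'(1,2) mult_carrier_mat by blast+
    show "det (P' * P) \<noteq> 0" "det (Q * Q') \<noteq> 0"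
      using PQ PQ' by (simp_all add: det_mult[of _ n])
    show "(P' * P) * E * (Q * Q') = E''" "(P' * P) * A * (Q * Q') = A''"
      using comp[OF E] comp[OF A] PQ(5,6) PQ'(5,6) by simp_all
  qed
qed

lemma nonsingular_inverse:
  fixes A :: "'a :: field mat"
  assumes A: "A \<in> carrier_mat n n" and d: "det A \<noteq> 0"
  obtains B where "B \<in> carrier_mat n n" "det B \<noteq> 0" "A * B = 1\<^sub>m n" "B * A = 1\<^sub>m n"
proof -
  obtain B where B: "B \<in> carrier_mat n n" "A * B = 1\<^sub>m n" "B * A = 1\<^sub>m n"
    using det_non_zero_imp_unit[OF A d, of "()"]
    by (auto simp: Units_def ring_mat_def)
  moreover have "det B \<noteq> 0" using det_mult[OF A B(1)] B(2) by auto
  ultimately show ?thesis using that by blast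
qed

lemma inverse_det_nonzero:
  fixes A :: "'a :: field mat"
  assumes A: "A \<in> carrier_mat n n" and B: "B \<in> carrier_mat n n" and AB: "A * B = 1\<^sub>m n"
  shows "det A \<noteq> 0" and "det B \<noteq> 0"
  using det_mult[OF A B] AB by auto

lemma nonsingular_invertible_mat:
  fixes A :: "'a :: field mat"
  assumes A: "A \<in> carrier_mat n n" and d: "det A \<noteq> 0"
  shows "invertible_mat A"
proof -
  obtain B where "B \<in> carrier_mat n n" "A * B = 1\<^sub>m n" "B * A = 1\<^sub>m n"
    using nonsingular_inverse[OF A d] by blast
  thus ?thesis using A unfolding invertible_mat_def inverts_mat_def by auto
qed

text \<open>The block diagonal matrix of \<open>B\<close> and \<open>C\<close>. The sizes \<open>r\<close> and \<open>s\<close> of the blocks are explicit, since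
  they fix the zero blocks; they are meant to be the sizes of \<open>B\<close> and \<open>C\<close>.\<close>

abbreviation block_diag :: "nat \<Rightarrow> nat \<Rightarrow> 'a :: zero mat \<Rightarrow> 'a mat \<Rightarrow> 'a mat" where
  "block_diag r s B C \<equiv> four_block_mat B (0\<^sub>m r s) (0\<^sub>m s r) C"

lemma block_diag_mult:
  fixes B B' C C' :: "'a :: comm_ring_1 mat"
  assumes "B \<in> carrier_mat r r" "B' \<in> carrier_mat r r" "C \<in> carrier_mat s s" "C' \<in> carrier_mat s s"
  shows "block_diag r s B C * block_diag r s B' C' = block_diag r s (B * B') (C * C')"
  using assms mult_four_block_mat[of B r r "0\<^sub>m r s" s "0\<^sub>m s r" s C B' r "0\<^sub>m r s" s "0\<^sub>m s r" C']
  by simp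

lemma strictly_equivalent_block_diag:
  assumes c: "E\<^sub>1 \<in> carrier_mat r r" "A\<^sub>1 \<in> carrier_mat r r" "E\<^sub>2 \<in> carrier_mat s s" "A\<^sub>2 \<in> carrier_mat s s"
    and 1: "strictly_equivalent r E\<^sub>1 A\<^sub>1 E\<^sub>1' A\<^sub>1'" and 2: "strictly_equivalent s E\<^sub>2 A\<^sub>2 E\<^sub>2' A\<^sub>2'"
  shows "strictly_equivalent (r + s) (block_diag r s E\<^sub>1 E\<^sub>2) (block_diag r s A\<^sub>1 A\<^sub>2)
    (block_diag r s E\<^sub>1' E\<^sub>2') (block_diag r s A\<^sub>1' A\<^sub>2')"
proof -
  obtain P Q where PQ: "P \<in> carrier_mat r r" "Q \<in> carrier_mat r r" "det P \<noteq> 0" "det Q \<noteq> 0"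
    "P * E\<^sub>1 * Q = E\<^sub>1'" "P * A\<^sub>1 * Q = A\<^sub>1'"
    using 1 unfolding strictly_equivalent_def by blast
  obtain P' Q' where PQ': "P' \<in> carrier_mat s s" "Q' \<in> carrier_mat s s" "det P' \<noteq> 0" "det Q' \<noteq> 0"
    "P' * E\<^sub>2 * Q' = E\<^sub>2'" "P' * A\<^sub>2 * Q' = A\<^sub>2'"
    using 2 unfolding strictly_equivalent_def by blast
  have mult: "block_diag r s P P' * block_diag r s M N * block_diag r s Q Q'
      = block_diag r s (P * M * Q) (P' * N * Q')"
    if M: "M \<in> carrier_mat r r" and N: "N \<in> carrier_mat s s" for M N
  proof -
    have "P * M \<in> carrier_mat r r" "P' * N \<in> carrier_mat s s"
      using PQ(1) PQ'(1) M N by (auto intro: mult_carrier_mat)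
    thus ?thesis
      using block_diag_mult[OF PQ(1) M PQ'(1) N] block_diag_mult[of "P * M" r Q "P' * N" s Q'] PQ(2) PQ'(2)
      by simp
  qed
  show ?thesis
  proof (rule strictly_equivalentI)
    show "block_diag r s P P' \<in> carrier_mat (r + s) (r + s)" "block_diag r s Q Q' \<in> carrier_mat (r + s) (r + s)"
      using PQ(1,2) PQ'(1,2) by (auto intro: four_block_carrier_mat)
    show "det (block_diag r s P P') \<noteq> 0" "det (block_diag r s Q Q') \<noteq> 0"
      using PQ PQ' by (simp_all add: det_four_block_mat_lower_left_zero[of _ r _ s])
  qed (use mult c PQ(5,6) PQ'(5,6) in simp_all)
qed

text \<open>The Fitting decomposition, read off from the Jordan normal form by moving the blocks with a
  nonzero eigenvalue to the front. That \<open>C\<close> is nilpotent is expressed by its spectrum.\<close>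
lemma nilpotent_invertible_split:
  fixes M :: "complex mat"
  assumes M: "M \<in> carrier_mat n n"
  obtains r s B C where "r + s = n" "B \<in> carrier_mat r r" "C \<in> carrier_mat s s"
    "similar_mat M (block_diag r s B C)" "det B \<noteq> 0" "\<And>c. eigenvalue C c \<Longrightarrow> c = 0"
proof -
  obtain xs where nf: "jordan_nf M xs" using complex_jordan_nf_exists[OF M] .
  let ?p = "filter (\<lambda>x. snd x \<noteq> 0) xs" and ?q = "filter (\<lambda>x. \<not> snd x \<noteq> 0) xs"
  let ?r = "sum_list (map fst ?p)" and ?s = "sum_list (map fst ?q)"
  let ?B = "jordan_matrix ?p" and ?C = "jordan_matrix ?q"
  have sim: "similar_mat M (block_diag ?r ?s ?B ?C)"
    using nf similar_mat_trans[OF _ similar_jordan_matrix_partition[of xs "\<lambda>x. snd x \<noteq> 0"]]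
    unfolding jordan_nf_def jordan_matrix_append by blast
  have "block_diag ?r ?s ?B ?C \<in> carrier_mat (?r + ?s) (?r + ?s)"
    by (rule four_block_carrier_mat) auto
  hence rs: "?r + ?s = n"
    using similar_matD[OF sim] M by (metis carrier_matD(1) insert_subset)
  have "\<not> eigenvalue ?B 0" using eigenvalue_jordan_matrixD[of ?p 0] by auto
  moreover have "char_matrix ?B 0 = ?B" by (rule eq_matI) (auto simp: char_matrix_def)
  ultimately have "det ?B \<noteq> 0" using eigenvalue_det[OF jordan_matrix_carrier, of ?p 0] by simp
  moreover have "c = 0" if "eigenvalue ?C c" for c using eigenvalue_jordan_matrixD[OF that] by auto
  ultimately show ?thesis using that[OF rs jordan_matrix_carrier jordan_matrix_carrier sim] by blast
qed

lemma strictly_equivalent_similar_right: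
  assumes B: "B \<in> carrier_mat r r" and sim: "similar_mat B B'"
  shows "strictly_equivalent r (1\<^sub>m r) B (1\<^sub>m r) B'" and "strictly_equivalent r B (1\<^sub>m r) B' (1\<^sub>m r)"
    and "strictly_equivalent r B (m \<cdot>\<^sub>m B - 1\<^sub>m r) B' (m \<cdot>\<^sub>m B' - 1\<^sub>m r)"
proof -
  obtain P Q where w: "similar_mat_wit B' B P Q"
    using similar_mat_sym[OF sim] unfolding similar_mat_def by blast
  have B': "B' \<in> carrier_mat r r"
    using similar_matD[OF sim] B by (metis carrier_matD(1) insert_subset)
  note w = similar_mat_witD2[OF B' w]
  have d: "det P \<noteq> 0" "det Q \<noteq> 0" using inverse_det_nonzero[OF w(6,7,1)] .
  have one: "P * 1\<^sub>m r * Q = 1\<^sub>m r" using w by simp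
  have B'_eq: "P * B * Q = B'" using w by simp
  have aff: "P * (m \<cdot>\<^sub>m B - 1\<^sub>m r) * Q = m \<cdot>\<^sub>m B' - 1\<^sub>m r"
  proof -
    have PB: "P * B \<in> carrier_mat r r" using w(6) B by (rule mult_carrier_mat)
    have "P * (m \<cdot>\<^sub>m B - 1\<^sub>m r) = m \<cdot>\<^sub>m (P * B) - P"
      using w(6) B by (simp add: mult_minus_distrib_mat[of _ r r _ r] mult_smult_distrib[of _ r r _ r])
    also have "\<dots> * Q = m \<cdot>\<^sub>m (P * B * Q) - P * Q"
      using w(6,7) PB by (simp add: minus_mult_distrib_mat[of _ r r _ _ r] mult_smult_assoc_mat[of _ r r _ r])
    finally show ?thesis using w(1) B'_eq by simp
  qed
  show "strictly_equivalent r (1\<^sub>m r) B (1\<^sub>m r) B'" "strictly_equivalent r B (1\<^sub>m r) B' (1\<^sub>m r)"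
    "strictly_equivalent r B (m \<cdot>\<^sub>m B - 1\<^sub>m r) B' (m \<cdot>\<^sub>m B' - 1\<^sub>m r)"
    using strictly_equivalentI[OF w(6,7) d] one B'_eq aff by blast+
qed

lemma strictly_equivalent_left_mult:
  assumes "P \<in> carrier_mat n n" "det P \<noteq> 0" "E \<in> carrier_mat n n" "A \<in> carrier_mat n n"
  shows "strictly_equivalent n E A (P * E) (P * A)"
  by (rule strictly_equivalentI[of P n "1\<^sub>m n"]) (use assms in \<open>auto intro: mult_carrier_mat right_mult_one_mat\<close>)

lemma finite_part_canonical:
  assumes B: "B \<in> carrier_mat r r" and d: "det B \<noteq> 0" and F: "F \<in> carrier_mat r r"
  obtains fs where "0 \<notin> fst ` set fs" "sum_list (map fst fs) = r"
    "strictly_equivalent r B F (1\<^sub>m r) (jordan_matrix fs)"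
proof -
  obtain B' where B': "B' \<in> carrier_mat r r" "det B' \<noteq> 0" "B' * B = 1\<^sub>m r"
    using nonsingular_inverse[OF B d] by blast
  have c: "B' * F \<in> carrier_mat r r" using B'(1) F by (rule mult_carrier_mat)
  obtain fs where nf: "jordan_nf (B' * F) fs" using complex_jordan_nf_exists[OF c] .
  hence sim: "similar_mat (B' * F) (jordan_matrix fs)" and "0 \<notin> fst ` set fs"
    by (auto simp: jordan_nf_def)
  moreover have "sum_list (map fst fs) = r"
    using similar_matD[OF sim] c by (metis carrier_matD(1) insert_subset jordan_matrix_dim(1))
  moreover have "strictly_equivalent r B F (1\<^sub>m r) (jordan_matrix fs)"
    using strictly_equivalent_trans[OF B F _ strictly_equivalent_similar_right(1)[OF c sim]]
      strictly_equivalent_left_mult[OF B'(1,2) B F] B'(3) by simp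
  ultimately show ?thesis using that by blast
qed

text \<open>For nilpotent \<open>C\<close> the matrix \<open>F = mC - I\<close> is nonsingular, and \<open>N = inverse(F) C\<close> is nilpotent: a
  nonzero eigenvalue of \<open>N\<close> would give one of \<open>C\<close> with the same eigenvector.\<close>

lemma infinite_part_canonical:
  assumes C: "C \<in> carrier_mat s s" and nil: "\<And>c. eigenvalue C c \<Longrightarrow> c = 0"
  obtains "is" where "0 \<notin> set is" "sum_list is = s"
    "strictly_equivalent s C (m \<cdot>\<^sub>m C - 1\<^sub>m s) (jordan_matrix (map (\<lambda>k. (k, 0)) is)) (1\<^sub>m s)"
proof -
  let ?F = "m \<cdot>\<^sub>m C - 1\<^sub>m s"
  have F: "?F \<in> carrier_mat s s" by (rule minus_carrier_mat) simp
  have Fv: "?F *\<^sub>v v = m \<cdot>\<^sub>v (C *\<^sub>v v) - v" if "v \<in> carrier_vec s" for v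
    using that C by (simp add: minus_mult_distrib_mat_vec[of _ s s] smult_mat_mult_vec[of _ s s])
  have ev: "c = 0" if "v \<in> carrier_vec s" "v \<noteq> 0\<^sub>v s" "C *\<^sub>v v = c \<cdot>\<^sub>v v" for v c
    using nil[of c] that C unfolding eigenvalue_def eigenvector_def by auto
  have "det ?F \<noteq> 0"
  proof
    assume "det ?F = 0"
    then obtain v where v: "v \<in> carrier_vec s" "v \<noteq> 0\<^sub>v s" "?F *\<^sub>v v = 0\<^sub>v s"
      using det_0_iff_vec_prod_zero[OF F] by blast
    define z where "z = C *\<^sub>v v"
    have z: "z \<in> carrier_vec s" unfolding z_def using C v(1) by (rule mult_mat_vec_carrier)
    have v_eq: "v = m \<cdot>\<^sub>v z"
    proof (rule eq_vecI)
      fix i assume "i < dim_vec (m \<cdot>\<^sub>v z)"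
      hence i: "i < s" using z by simp
      have "(m \<cdot>\<^sub>v z - v) $ i = 0" using v(3) Fv[OF v(1)] i by (simp add: z_def)
      thus "v $ i = (m \<cdot>\<^sub>v z) $ i" using i v(1) z by simp
    qed (use v(1) z in simp)
    have "m \<noteq> 0"
    proof
      assume "m = 0"
      hence "v = 0\<^sub>v s" using v_eq z by auto
      thus False using v(2) by simp
    qed
    moreover from this have "C *\<^sub>v v = inverse m \<cdot>\<^sub>v v"
      unfolding z_def[symmetric] using v_eq by (simp add: smult_smult_assoc)
    hence "inverse m = 0" using ev[OF v(1,2)] by blast
    ultimately show False by simp
  qed
  then obtain F' where F': "F' \<in> carrier_mat s s" "det F' \<noteq> 0" "?F * F' = 1\<^sub>m s" "F' * ?F = 1\<^sub>m s"
    using nonsingular_inverse[OF F] by blast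
  let ?N = "F' * C"
  have N: "?N \<in> carrier_mat s s" using F'(1) C by (rule mult_carrier_mat)
  have nilN: "c = 0" if e: "eigenvalue ?N c" for c
  proof (rule ccontr)
    assume c: "c \<noteq> 0"
    obtain v where v: "v \<in> carrier_vec s" "v \<noteq> 0\<^sub>v s" "?N *\<^sub>v v = c \<cdot>\<^sub>v v"
      using e unfolding eigenvalue_def eigenvector_def carrier_matD(1)[OF N] by blast
    define z where "z = C *\<^sub>v v"
    have z: "z \<in> carrier_vec s" unfolding z_def using C v(1) by (rule mult_mat_vec_carrier)
    have "z = ?F * F' * C *\<^sub>v v" using F' C by (simp add: z_def)
    also have "\<dots> = ?F *\<^sub>v (?N *\<^sub>v v)"
      using F F'(1) C v(1) by (simp add: assoc_mult_mat_vec[of _ s s _ s] assoc_mult_mat[of _ s s _ s _ s])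
    also have "\<dots> = c \<cdot>\<^sub>v (?F *\<^sub>v v)" using mult_mat_vec[OF F v(1)] v(3) by simp
    finally have *: "z = c \<cdot>\<^sub>v (m \<cdot>\<^sub>v z - v)" using Fv[OF v(1)] by (simp add: z_def)
    have pt: "(1 - c * m) * z $ i = - c * v $ i" if i: "i < s" for i
      using arg_cong[OF *, of "\<lambda>x. x $ i"] i z v(1) by (simp add: algebra_simps)
    show False
    proof (cases "1 - c * m = 0")
      case True
      hence "v $ i = 0" if "i < s" for i using pt[OF that] c by simp
      thus False using v(1,2) by (auto simp: vec_eq_iff)
    next
      case False
      have "z = (- c / (1 - c * m)) \<cdot>\<^sub>v v"
        using pt False v(1) z by (intro eq_vecI) (auto simp: field_simps)
      hence "C *\<^sub>v v = (- c / (1 - c * m)) \<cdot>\<^sub>v v" by (simp only: z_def)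
      from ev[OF v(1,2) this] c False show False by simp
    qed
  qed
  obtain xs where nf: "jordan_nf ?N xs" using complex_jordan_nf_exists[OF N] .
  hence sim: "similar_mat ?N (jordan_matrix xs)" and pos: "0 \<notin> fst ` set xs"
    by (auto simp: jordan_nf_def)
  define ks where "ks = map fst xs"
  have "snd x = 0" if "x \<in> set xs" for x
    using nilN jordan_nf_eigenvalue_iff[OF N nf] that by blast
  hence xs: "map (\<lambda>k. (k, 0)) ks = xs" by (auto simp: ks_def map_idI prod_eq_iff)
  have "sum_list ks = s"
    using similar_matD[OF sim] N unfolding ks_def by (metis carrier_matD(1) insert_subset jordan_matrix_dim(1))
  moreover have "0 \<notin> set ks" using pos by (simp add: ks_def)
  moreover have "strictly_equivalent s C ?F (jordan_matrix (map (\<lambda>k. (k, 0)) ks)) (1\<^sub>m s)"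
    unfolding xs
    using strictly_equivalent_trans[OF C F _ strictly_equivalent_similar_right(2)[OF N sim]]
      strictly_equivalent_left_mult[OF F'(1,2) C F] F'(4) by simp
  ultimately show ?thesis using that by blast
qed

text \<open>Choose \<open>m\<close> with \<open>mE - A\<close> nonsingular and multiply from the left by its inverse \<open>K\<close>. The new
  coefficients \<open>M = KE\<close> and \<open>KA = mM - I\<close> are polynomials in the same matrix, so one similarity
  splits both into the part where \<open>M\<close> is nonsingular, which carries the finite eigenvalues, and
  the part where \<open>M\<close> is nilpotent, which carries the eigenvalue \<open>\<infinity>\<close>.\<close>

theorem weierstrass_form_exists:
  assumes E: "E \<in> carrier_mat n n" and A: "A \<in> carrier_mat n n" and reg: "regular_pencil E A"
  shows "\<exists>fs is. weierstrass_form n E A fs is"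
proof -
  obtain m where m: "det (m \<cdot>\<^sub>m E - A) \<noteq> 0" using reg by (auto simp: regular_pencil_def)
  have S: "m \<cdot>\<^sub>m E - A \<in> carrier_mat n n" using A by (rule minus_carrier_mat)
  obtain K where K: "K \<in> carrier_mat n n" "det K \<noteq> 0" "K * (m \<cdot>\<^sub>m E - A) = 1\<^sub>m n"
    using nonsingular_inverse[OF S m] by blast
  let ?M = "K * E"
  have M: "?M \<in> carrier_mat n n" and KA: "K * A \<in> carrier_mat n n"
    using K(1) E A by (auto intro: mult_carrier_mat)
  have "m \<cdot>\<^sub>m ?M - K * A = 1\<^sub>m n"
    using K E A by (simp add: mult_minus_distrib_mat[of _ n n _ n] mult_smult_distrib[of _ n n _ n])
  moreover have "X - (X - Y) = Y" if "X \<in> carrier_mat n n" "Y \<in> carrier_mat n n" for X Y :: "complex mat"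
    using that by (intro eq_matI) auto
  ultimately have KA_eq: "K * A = m \<cdot>\<^sub>m ?M - 1\<^sub>m n" using M KA by (metis smult_carrier_mat)
  obtain r s B C where rs: "r + s = n" and B: "B \<in> carrier_mat r r" "det B \<noteq> 0"
    and C: "C \<in> carrier_mat s s" "\<And>c. eigenvalue C c \<Longrightarrow> c = 0"
    and sim: "similar_mat ?M (block_diag r s B C)"
    using nilpotent_invertible_split[OF M] by metis
  let ?D = "block_diag r s B C"
  have mB: "m \<cdot>\<^sub>m B - 1\<^sub>m r \<in> carrier_mat r r" and mC: "m \<cdot>\<^sub>m C - 1\<^sub>m s \<in> carrier_mat s s"
    by (rule minus_carrier_mat, simp)+
  have D_eq: "m \<cdot>\<^sub>m ?D - 1\<^sub>m (r + s) = block_diag r s (m \<cdot>\<^sub>m B - 1\<^sub>m r) (m \<cdot>\<^sub>m C - 1\<^sub>m s)"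
    using B C by (intro eq_matI) auto
  obtain fs where fs: "0 \<notin> fst ` set fs" "sum_list (map fst fs) = r"
    "strictly_equivalent r B (m \<cdot>\<^sub>m B - 1\<^sub>m r) (1\<^sub>m r) (jordan_matrix fs)"
    using finite_part_canonical[OF B mB] by blast
  obtain ks where ks: "0 \<notin> set ks" "sum_list ks = s"
    "strictly_equivalent s C (m \<cdot>\<^sub>m C - 1\<^sub>m s) (jordan_matrix (map (\<lambda>k. (k, 0)) ks)) (1\<^sub>m s)"
    using infinite_part_canonical[OF C] by blast
  let ?E' = "block_diag r s (1\<^sub>m r) (jordan_matrix (map (\<lambda>k. (k, 0)) ks))"
  let ?A' = "block_diag r s (jordan_matrix fs) (1\<^sub>m s)"
  have "strictly_equivalent (r + s) ?D (m \<cdot>\<^sub>m ?D - 1\<^sub>m (r + s)) ?E' ?A'"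
    unfolding D_eq by (rule strictly_equivalent_block_diag[OF B(1) mB C(1) mC fs(3) ks(3)])
  hence "strictly_equivalent n ?D (m \<cdot>\<^sub>m ?D - 1\<^sub>m n) ?E' ?A'" unfolding rs .
  from strictly_equivalent_trans[OF M _ strictly_equivalent_similar_right(3)[OF M sim] this]
  have "strictly_equivalent n ?M (K * A) ?E' ?A'" using KA KA_eq by simp
  from strictly_equivalent_trans[OF E A strictly_equivalent_left_mult[OF K(1,2) E A] this]
  obtain P Q where PQ: "P \<in> carrier_mat n n" "Q \<in> carrier_mat n n" "det P \<noteq> 0" "det Q \<noteq> 0"
    "P * E * Q = ?E'" "P * A * Q = ?A'"
    unfolding strictly_equivalent_def by blast
  have "weierstrass_form n E A fs ks"
    unfolding weierstrass_form_def Let_def fs(2) ks(2)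
    using fs(1) ks(1) PQ nonsingular_invertible_mat[OF PQ(1,3)] nonsingular_invertible_mat[OF PQ(2,4)]
    by blast
  thus ?thesis by blast
qed

section \<open>Eigenvalues on the imaginary axis\<close>

lemma full_column_rank_inj:
  assumes W: "full_column_rank n k W" and x: "x \<in> carrier_vec k" and Wx: "W *\<^sub>v x = 0\<^sub>v n"
  shows "x = 0\<^sub>v k"
proof -
  interpret vec_space "TYPE(complex)" n .
  have Wc: "W \<in> carrier_mat n k" and rk: "rank W = k"
    using W by (auto simp: full_column_rank_def)
  have len: "length (cols W) = k" and cc: "set (cols W) \<subseteq> carrier_vec n"
    using Wc cols_dim[of W] by auto
  have dist: "distinct (cols W)"
  proof -
    obtain S where S: "maximal S (\<lambda>T. T \<subseteq> set (cols W) \<and> lin_indpt T)"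
      using maximal_exists_superset[of "set (cols W)" "\<lambda>T. T \<subseteq> set (cols W) \<and> lin_indpt T" "{}"]
        finite_lin_indpt2[of "{}"] by auto
    hence "card S = k" using rank_card_indpt[OF Wc S] rk by simp
    hence "k \<le> card (set (cols W))" using S by (metis card_mono List.finite_set maximal_def)
    thus ?thesis using len card_length[of "cols W"] by (intro card_distinct) simp
  qed
  have ind: "lin_indpt (set (cols W))" by (rule full_rank_lin_indpt[OF Wc rk dist])
  \<comment> \<open>Linear combinations are indexed by the vectors, which is harmless as the columns are
    distinct.\<close>
  define a where "a c = x $ (THE i. i < k \<and> col W i = c)" for c
  have a: "a (col W i) = x $ i" if "i < k" for i
  proof -
    have "(THE j. j < k \<and> col W j = col W i) = i"
      using dist that len Wc by (intro the_equality) (auto simp: distinct_conv_nth)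
    thus ?thesis by (simp add: a_def)
  qed
  have "vec k (\<lambda>i. a (col W i)) = x" using a x by (auto simp: vec_eq_iff)
  hence "lincomb a (set (cols W)) = 0\<^sub>v n"
    using mat_mult_eq_lincomb[OF Wc dist, of a] Wx by simp
  hence "\<forall>c \<in> set (cols W). a c = 0"
    using ind not_lindepD[OF ind _ subset_refl, of a] by auto
  hence "x $ i = 0" if "i < k" for i
    using that a[OF that] len Wc by (metis carrier_matD(2) cols_length cols_nth nth_mem)
  thus ?thesis using x by (auto simp: vec_eq_iff)
qed

text \<open>A nontrivial finite block of the canonical form yields a Jordan chain of the pencil; its first
  vector is not in the kernel of \<open>E\<close>, because \<open>E\<close> acts as the identity on the finite part.\<close>

lemma weierstrass_form_chain:
  assumes E: "E \<in> carrier_mat n n" and A: "A \<in> carrier_mat n n"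
    and wf: "weierstrass_form n E A fs is" and mem: "(m, l) \<in> set fs" and m: "m \<noteq> 1"
  obtains u w where "u \<in> carrier_vec n" "w \<in> carrier_vec n" "E *\<^sub>v u \<noteq> 0\<^sub>v n"
    "A *\<^sub>v u = l \<cdot>\<^sub>v (E *\<^sub>v u)" "A *\<^sub>v w = l \<cdot>\<^sub>v (E *\<^sub>v w) + E *\<^sub>v u"
proof -
  define r where "r = sum_list (map fst fs)"
  define s where "s = sum_list is"
  define N :: "complex mat" where "N = jordan_matrix (map (\<lambda>m. (m, 0)) is)"
  have N: "N \<in> carrier_mat s s"
    using jordan_matrix_carrier[of "map (\<lambda>m. (m, 0 :: complex)) is"] by (simp add: N_def s_def o_def)
  have Jf: "jordan_matrix fs \<in> carrier_mat r r" unfolding r_def by (rule jordan_matrix_carrier)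
  obtain P Q where PQ: "P \<in> carrier_mat n n" "Q \<in> carrier_mat n n" "invertible_mat P"
    and PEQ: "P * E * Q = block_diag r s (1\<^sub>m r) N"
    and PAQ: "P * A * Q = block_diag r s (jordan_matrix fs) (1\<^sub>m s)"
    using wf unfolding weierstrass_form_def Let_def r_def s_def N_def by blast
  have rs: "r + s = n"
  proof -
    have "dim_row (P * E * Q) = n" using PQ by simp
    thus ?thesis unfolding PEQ using N by simp
  qed
  obtain P' where P': "P' \<in> carrier_mat n n" "P' * P = 1\<^sub>m n"
  proof -
    obtain B where B: "P * B = 1\<^sub>m (dim_row P)" "B * P = 1\<^sub>m (dim_row B)"
      using PQ(3) unfolding invertible_mat_def inverts_mat_def by blast
    have "B \<in> carrier_mat n n"
      using arg_cong[OF B(1), of dim_col] arg_cong[OF B(2), of dim_col] PQ(1)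
      by (intro carrier_matI) auto
    thus ?thesis using that B(2) by auto
  qed
  have inj: "a = b" if "P *\<^sub>v a = P *\<^sub>v b" "a \<in> carrier_vec n" "b \<in> carrier_vec n" for a b
    using arg_cong[OF that(1), of "\<lambda>v. P' *\<^sub>v v"] that(2,3) P' PQ(1)
    by (simp flip: assoc_mult_mat_vec[of _ n n _ n])
  have "m \<noteq> 0" using wf mem by (force simp: weierstrass_form_def)
  with m have "2 \<le> m" by simp
  from jordan_matrix_chain[OF mem this] obtain x y where
    x: "x \<in> carrier_vec r" "x \<noteq> 0\<^sub>v r" and y: "y \<in> carrier_vec r"
    and Jx: "jordan_matrix fs *\<^sub>v x = l \<cdot>\<^sub>v x" and Jy: "jordan_matrix fs *\<^sub>v y = l \<cdot>\<^sub>v y + x"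
    unfolding r_def by blast
  let ?pad = "\<lambda>v. v @\<^sub>v 0\<^sub>v s :: complex vec"
  have pad: "?pad v \<in> carrier_vec n" if "v \<in> carrier_vec r" for v
    using that rs by (auto intro: append_carrier_vec)
  have Epad: "P *\<^sub>v (E *\<^sub>v (Q *\<^sub>v ?pad v)) = ?pad v" if v: "v \<in> carrier_vec r" for v
  proof -
    have "P *\<^sub>v (E *\<^sub>v (Q *\<^sub>v ?pad v)) = P * E * Q *\<^sub>v ?pad v"
      using PQ(1,2) E pad[OF v] by (simp add: assoc_mult_mat_vec[of _ n n _ n] mult_carrier_mat[of _ n n])
    also have "\<dots> = (1\<^sub>m r *\<^sub>v v) @\<^sub>v (N *\<^sub>v 0\<^sub>v s)"
      unfolding PEQ using v N by (intro mult_mat_vec_split) auto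
    also have "N *\<^sub>v 0\<^sub>v s = 0\<^sub>v s" using N by (intro eq_vecI) auto
    finally show ?thesis using v by simp
  qed
  have Apad: "P *\<^sub>v (A *\<^sub>v (Q *\<^sub>v ?pad v)) = ?pad (jordan_matrix fs *\<^sub>v v)" if v: "v \<in> carrier_vec r" for v
  proof -
    have "P *\<^sub>v (A *\<^sub>v (Q *\<^sub>v ?pad v)) = P * A * Q *\<^sub>v ?pad v"
      using PQ(1,2) A pad[OF v] by (simp add: assoc_mult_mat_vec[of _ n n _ n] mult_carrier_mat[of _ n n])
    also have "\<dots> = (jordan_matrix fs *\<^sub>v v) @\<^sub>v (1\<^sub>m s *\<^sub>v 0\<^sub>v s)"
      unfolding PAQ using v Jf by (intro mult_mat_vec_split) auto
    finally show ?thesis by simp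
  qed
  define u where "u = Q *\<^sub>v ?pad x"
  define w where "w = Q *\<^sub>v ?pad y"
  have u: "u \<in> carrier_vec n" and w: "w \<in> carrier_vec n"
    unfolding u_def w_def using mult_mat_vec_carrier[OF PQ(2)] pad x(1) y by blast+
  have Eu: "E *\<^sub>v u \<in> carrier_vec n" and Ew: "E *\<^sub>v w \<in> carrier_vec n"
    and Au: "A *\<^sub>v u \<in> carrier_vec n" and Aw: "A *\<^sub>v w \<in> carrier_vec n"
    using mult_mat_vec_carrier[OF E] mult_mat_vec_carrier[OF A] u w by blast+
  have PEu: "P *\<^sub>v (E *\<^sub>v u) = ?pad x" and PEw: "P *\<^sub>v (E *\<^sub>v w) = ?pad y"
    unfolding u_def w_def by (rule Epad[OF x(1)], rule Epad[OF y])
  have PAu: "P *\<^sub>v (A *\<^sub>v u) = ?pad (l \<cdot>\<^sub>v x)" and PAw: "P *\<^sub>v (A *\<^sub>v w) = ?pad (l \<cdot>\<^sub>v y + x)"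
    unfolding u_def w_def Jx[symmetric] Jy[symmetric] by (rule Apad[OF x(1)], rule Apad[OF y])
  have "P *\<^sub>v (A *\<^sub>v u) = P *\<^sub>v (l \<cdot>\<^sub>v (E *\<^sub>v u))"
    unfolding mult_mat_vec[OF PQ(1) Eu] PEu PAu by (intro eq_vecI) auto
  hence 1: "A *\<^sub>v u = l \<cdot>\<^sub>v (E *\<^sub>v u)" using inj Au Eu by simp
  have lEw: "l \<cdot>\<^sub>v (E *\<^sub>v w) \<in> carrier_vec n" using Ew by simp
  have "P *\<^sub>v (A *\<^sub>v w) = P *\<^sub>v (l \<cdot>\<^sub>v (E *\<^sub>v w) + E *\<^sub>v u)"
    unfolding mult_add_distrib_mat_vec[OF PQ(1) lEw Eu] mult_mat_vec[OF PQ(1) Ew] PEu PEw PAw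
    using x y by (intro eq_vecI) auto
  hence 2: "A *\<^sub>v w = l \<cdot>\<^sub>v (E *\<^sub>v w) + E *\<^sub>v u"
    by (rule inj[OF _ Aw]) (rule add_carrier_vec[OF lEw Eu])
  have 3: "E *\<^sub>v u \<noteq> 0\<^sub>v n"
  proof
    assume "E *\<^sub>v u = 0\<^sub>v n"
    hence "?pad x = P *\<^sub>v 0\<^sub>v n" using PEu by simp
    also have "\<dots> = 0\<^sub>v r @\<^sub>v 0\<^sub>v s" using PQ(1) rs by (intro eq_vecI) auto
    finally show False using x append_vec_eq[OF x(1) zero_carrier_vec, of "0\<^sub>v s" "0\<^sub>v s"] by simp
  qed
  show ?thesis by (rule that[OF u w 3 1 2])
qed

context dissipative_pencil
begin

lemma imaginary_eigenvalue_semisimple: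
  assumes reg: "regular_pencil \<E> \<A>" and ev: "pencil_eigenvalue \<E> \<A> l" and im: "Re l = 0"
  shows "semisimple_eigenvalue n \<E> \<A> l"
proof -
  have "m = 1" if wf: "weierstrass_form n \<E> \<A> fs is" and mem: "(m, l) \<in> set fs" for fs "is" m
  proof (rule ccontr)
    assume "m \<noteq> 1"
    from weierstrass_form_chain[OF carriers(3,5) wf mem this] obtain u w where
      "u \<in> carrier_vec n" "w \<in> carrier_vec n" "\<E> *\<^sub>v u \<noteq> 0\<^sub>v n"
      "\<A> *\<^sub>v u = l \<cdot>\<^sub>v (\<E> *\<^sub>v u)" "\<A> *\<^sub>v w = l \<cdot>\<^sub>v (\<E> *\<^sub>v w) + \<E> *\<^sub>v u"
      by blast
    thus False using no_imaginary_jordan_chain[OF _ _ im] by blast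
  qed
  thus ?thesis
    unfolding semisimple_eigenvalue_def
    using ev weierstrass_form_exists[OF carriers(3,5) reg] by blast
qed

text \<open>The matrix \<open>T\<close> is \<open>l I\<close>, since \<open>V\<close> would map a Jordan chain of \<open>T\<close> to one of the pencil whose first
  vector is not in the kernel of \<open>E\<close>, the columns of \<open>E V\<close> being independent. Hence the range of
  \<open>V\<close> consists of eigenvectors.\<close>

lemma imaginary_deflating_subspace_in_kernel_R:
  assumes basis: "regular_deflating_basis n k \<E> \<A> l V" and im: "Re l = 0"
  shows "\<R> * V = 0\<^sub>m n k"
proof -
  obtain W T where V: "V \<in> carrier_mat n k" and W: "full_column_rank n k W"
    and T: "T \<in> carrier_mat k k" and spec: "spectrum T = {l}"
    and EV: "\<E> * V = W" and AV: "\<A> * V = W * T"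
    using basis unfolding regular_deflating_basis_def full_column_rank_def by blast
  have Wc: "W \<in> carrier_mat n k" using W by (simp add: full_column_rank_def)
  have EVv: "\<E> *\<^sub>v (V *\<^sub>v x) = W *\<^sub>v x" and AVv: "\<A> *\<^sub>v (V *\<^sub>v x) = W *\<^sub>v (T *\<^sub>v x)"
    if x: "x \<in> carrier_vec k" for x
    using assoc_mult_mat_vec[OF carriers(3) V x] assoc_mult_mat_vec[OF carriers(5) V x]
      assoc_mult_mat_vec[OF Wc T x] EV AV by simp_all
  obtain fs where nf: "jordan_nf T fs" using complex_jordan_nf_exists[OF T] .
  have only_l: "a = l" if "(m, a) \<in> set fs" for m a
    using jordan_nf_eigenvalue_iff[OF T nf, of a] that spec by (force simp: spectrum_def)
  obtain S S' where wit: "similar_mat_wit T (jordan_matrix fs) S S'"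
    using nf by (auto simp: jordan_nf_def similar_mat_def)
  note wit = similar_mat_witD2[OF T wit]
  have size: "sum_list (map fst fs) = k" using carrier_matD(1)[OF wit(5)] by simp
  have blocks: "m = 1" if mem: "(m, a) \<in> set fs" for m a
  proof (rule ccontr)
    assume "m \<noteq> 1"
    moreover have "m \<noteq> 0" using nf mem by (force simp: jordan_nf_def)
    ultimately have m: "2 \<le> m" by simp
    have mem': "(m, l) \<in> set fs" using mem only_l[OF mem] by simp
    obtain x y where xy: "x \<in> carrier_vec k" "y \<in> carrier_vec k" "x \<noteq> 0\<^sub>v k"
      "jordan_matrix fs *\<^sub>v x = l \<cdot>\<^sub>v x" "jordan_matrix fs *\<^sub>v y = l \<cdot>\<^sub>v y + x"
      using jordan_matrix_chain[OF mem' m] unfolding size by blast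
    have TS: "T *\<^sub>v (S *\<^sub>v v) = S *\<^sub>v (jordan_matrix fs *\<^sub>v v)" if v: "v \<in> carrier_vec k" for v
    proof -
      have Sv: "S *\<^sub>v v \<in> carrier_vec k" using wit(6) v by (rule mult_mat_vec_carrier)
      have "T *\<^sub>v (S *\<^sub>v v) = S *\<^sub>v (jordan_matrix fs *\<^sub>v (S' *\<^sub>v (S *\<^sub>v v)))"
        unfolding wit(3) using wit(5-7) Sv
        by (simp add: assoc_mult_mat_vec[of _ k k _ k] mult_carrier_mat[of _ k k])
      also have "S' *\<^sub>v (S *\<^sub>v v) = v" using assoc_mult_mat_vec[OF wit(7,6) v] wit(2) v by simp
      finally show ?thesis .
    qed
    define a where "a = S *\<^sub>v x"
    define b where "b = S *\<^sub>v y"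
    have a: "a \<in> carrier_vec k" and b: "b \<in> carrier_vec k"
      unfolding a_def b_def using wit(6) xy(1,2) by (auto intro: mult_mat_vec_carrier)
    have Ta: "T *\<^sub>v a = l \<cdot>\<^sub>v a"
      unfolding a_def TS[OF xy(1)] xy(4) by (rule mult_mat_vec[OF wit(6) xy(1)])
    have ly: "l \<cdot>\<^sub>v y \<in> carrier_vec k" using xy(2) by simp
    have Tb: "T *\<^sub>v b = l \<cdot>\<^sub>v b + a"
      unfolding a_def b_def TS[OF xy(2)] xy(5) mult_add_distrib_mat_vec[OF wit(6) ly xy(1)]
        mult_mat_vec[OF wit(6) xy(2)] ..
    have a0: "a \<noteq> 0\<^sub>v k"
    proof
      assume "a = 0\<^sub>v k"
      hence "S' *\<^sub>v (S *\<^sub>v x) = 0\<^sub>v k" using wit(7) by (auto simp: a_def intro!: eq_vecI)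
      thus False using assoc_mult_mat_vec[OF wit(7,6) xy(1)] wit(2) xy(1,3) by simp
    qed
    have Va: "V *\<^sub>v a \<in> carrier_vec n" and Vb: "V *\<^sub>v b \<in> carrier_vec n"
      using V a b by (auto intro: mult_mat_vec_carrier)
    have "\<A> *\<^sub>v (V *\<^sub>v a) = l \<cdot>\<^sub>v (\<E> *\<^sub>v (V *\<^sub>v a))"
      unfolding AVv[OF a] EVv[OF a] Ta by (rule mult_mat_vec[OF Wc a])
    moreover have lb: "l \<cdot>\<^sub>v b \<in> carrier_vec k" using b by simp
    have "\<A> *\<^sub>v (V *\<^sub>v b) = l \<cdot>\<^sub>v (\<E> *\<^sub>v (V *\<^sub>v b)) + \<E> *\<^sub>v (V *\<^sub>v a)"
      unfolding AVv[OF b] EVv[OF a] EVv[OF b] Tb mult_add_distrib_mat_vec[OF Wc lb a]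
        mult_mat_vec[OF Wc b] ..
    ultimately have "\<E> *\<^sub>v (V *\<^sub>v a) = 0\<^sub>v n"
      by (rule no_imaginary_jordan_chain[OF Va Vb im])
    hence "a = 0\<^sub>v k" using full_column_rank_inj[OF W a] EVv[OF a] by simp
    thus False using a0 by simp
  qed
  have "jordan_matrix fs = l \<cdot>\<^sub>m 1\<^sub>m k"
    using jordan_matrix_all_blocks_one[of fs l] blocks only_l unfolding size by blast
  hence T_eq: "T = l \<cdot>\<^sub>m 1\<^sub>m k"
    using wit by (simp add: mult_smult_distrib[of _ k k _ k] mult_smult_assoc_mat[of _ k k _ k])
  have "\<R> *\<^sub>v (V *\<^sub>v x) = 0\<^sub>v n" if x: "x \<in> carrier_vec k" for x
  proof (rule imaginary_eigenvector_in_kernel_R[OF _ _ im])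
    show "V *\<^sub>v x \<in> carrier_vec n" using V x by (rule mult_mat_vec_carrier)
    have "T *\<^sub>v x = l \<cdot>\<^sub>v x" unfolding T_eq using x by (simp add: smult_mat_mult_vec[of _ k k])
    thus "\<A> *\<^sub>v (V *\<^sub>v x) = l \<cdot>\<^sub>v (\<E> *\<^sub>v (V *\<^sub>v x))"
      unfolding AVv[OF x] EVv[OF x] using mult_mat_vec[OF Wc x] by simp
  qed
  hence RV: "(\<R> * V) *\<^sub>v x = 0\<^sub>v n" if "x \<in> carrier_vec k" for x
    using that assoc_mult_mat_vec[OF carriers(4) V that] by simp
  show ?thesis
  proof (rule eq_matI)
    fix i j assume "i < dim_row (0\<^sub>m n k :: complex mat)" "j < dim_col (0\<^sub>m n k :: complex mat)"
    hence ij: "i < n" "j < k" by simp_all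
    have "M $$ (i, j) = (M *\<^sub>v unit_vec k j) $ i" if "M \<in> carrier_mat n k" for M :: "complex mat"
      using that ij by simp
    from this[OF mult_carrier_mat[OF carriers(4) V]]
    show "(\<R> * V) $$ (i, j) = 0\<^sub>m n k $$ (i, j)" using RV[of "unit_vec k j"] ij by simp
  qed (use V carrier_matD(1)[OF carriers(2)] in auto)
qed

end

theorem theorem7p20:
  fixes n :: nat and E J R :: "real mat"
  assumes "J \<in> carrier_mat n n" and "J = - transpose_mat J"
    and "pos_semidef n R"
    and "pos_semidef n E"
    and "regular_pencil (complexify E) (complexify (J - R))"
    and "kronecker_index n (complexify E) (complexify (J - R)) \<le> 1"
  shows "(\<forall>l. pencil_eigenvalue (complexify E) (complexify (J - R)) l \<longrightarrow> Re l \<le> 0) \<and>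
    (\<forall>\<omega>::real. pencil_eigenvalue (complexify E) (complexify (J - R)) (\<i> * complex_of_real \<omega>) \<longrightarrow>
       semisimple_eigenvalue n (complexify E) (complexify (J - R)) (\<i> * complex_of_real \<omega>) \<and>
       (\<forall>k V. regular_deflating_basis n k (complexify E) (complexify (J - R))
                 (\<i> * complex_of_real \<omega>) V \<longrightarrow>
          complexify R * V = 0\<^sub>m n k))"
proof -
  interpret dissipative_pencil n E J R
    using assms(1-4) by unfold_locales
  have "Re (\<i> * complex_of_real \<omega>) = 0" for \<omega> by simp
  thus ?thesis
    using eigenvalue_Re_nonpos[OF assms(5)] imaginary_eigenvalue_semisimple[OF assms(5)]
      imaginary_deflating_subspace_in_kernel_R by blast
qed

end
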